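(* Let $v \in \mathbb{N}$ be fixed, let $g_v(x) = x^{2v+1}$ for $x\in\mathbb{R}$, and let $f_v(x,z)$ be the two-variable real polynomial $f_v(x,z)=\sum_{k=1}^{z}\sum_{r=0}^{v}\mathbf{A}_{v,r}\,k^r(x-k)^r$ (understood as a polynomial in $(x,z)\in\mathbb{R}^2$, with coefficients $\mathbf{A}_{v,r}$, as defined in the context). Then for every $u\in\mathbb{R}$, the ordinary derivative of $g_v$ at $u$ equals the sum of the two partial derivatives of $f_v$ at the point $(u,u)$: $$\frac{d g_v}{dx}(u) = \frac{\partial f_v}{\partial x}(u,u) + \frac{\partial f_v}{\partial z}(u,u).$$
   Context: Coefficients. For $m\in\mathbb{N}$ the real numbers $\mathbf{A}_{m,r}$, $0\le r\le m$, are defined recursively (downward in $r$) by $$\mathbf{A}_{m,m}=(2m+1)\binom{2m}{m},\qquad \mathbf{A}_{m,r}=(2r+1)\binom{2r}{r}\sum_{d=2r+1}^{m}\mathbf{A}_{m,d}\binom{d}{2r+1}\frac{(-1)^{d-1}}{d-r}B_{2d-2r}\quad(0\le r<m),$$ where $B_j$ are the Bernoulli numbers ($B_2=\tfrac16$, $B_4=-\tfrac1{30}$, ...) and an empty sum is $0$. Previously known and recalled fact: these coefficients satisfy, for all positive integers $n$, $$n^{2m+1}=\sum_{k=1}^{n}\sum_{r=0}^{m}\mathbf{A}_{m,r}\,k^r(n-k)^r ,$$ with the convention $0^0=1$ (and they are the only real numbers with this property). The function $f_y$. For fixed $y\in\mathbb{N}$, $$f_y(x,z)=\sum_{r=0}^{y}\mathbf{A}_{y,r}\Big[\sum_{k=1}^{z}k^r(x-k)^r\Big],\qquad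 x,z\in\mathbb{R},$$ where for each $r$ the bracket $\sum_{k=1}^{z}k^r(x-k)^r$ denotes the polynomial in $x,z$ given by Faulhaber's formula, i.e. the unique real polynomial $S_r(x,z)$ in two variables which, for every $x\in\mathbb{R}$ and every positive integer $z$, equals the finite sum $\sum_{k=1}^{z}k^r(x-k)^r$ (with $0^0=1$). For example $f_1(x,z)=3xz-3z^2+3xz^2-2z^3$. The partial derivatives $\partial f_y/\partial x$ and $\partial f_y/\partial z$ are the usual ones with respect to the first and second variable. *)

theory Defs
  imports "HOL-Analysis.Analysis" "HOL-Computational_Algebra.Computational_Algebra"
begin

function bernoulli :: "nat \<Rightarrow> real" where
  "bernoulli n =
     (if n = 0 then 1
      else - (\<Sum>k<n. real (Suc n choose k) * bernoulli k) / real (Suc n))"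
  by pat_completeness auto
termination by (relation "Wellfounded.measure id") auto

declare bernoulli.simps [simp del]

text \<open>
  The paper defines \<open>A_coef m r\<close> only for \<open>r \<le> m\<close>; the value \<open>0\<close> for \<open>r > m\<close> is never used.
\<close>

function A_coef :: "nat \<Rightarrow> nat \<Rightarrow> real" where
  "A_coef m r =
     (if r > m then 0
      else if r = m then real ((2 * m + 1) * (2 * m choose m))
      else real ((2 * r + 1) * (2 * r choose r)) *
           (\<Sum>d = 2 * r + 1..m.
              A_coef m d * real (d choose (2 * r + 1)) *
              ((-1) ^ (d - 1) / (real d - real r)) * bernoulli (2 * d - 2 * r)))"
  by pat_completeness auto
termination by (relation "Wellfounded.measure (\<lambda>(m, r). m - r)") auto

declare A_coef.simps [simp del]

text \<open>
  A two-variable real polynomial in \<open>(x, z)\<close> is encoded as a polynomial in \<open>z\<close> whose coefficients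
  are polynomials in \<open>x\<close>.
\<close>

definition eval2 :: "real poly poly \<Rightarrow> real \<Rightarrow> real \<Rightarrow> real" where
  "eval2 p x z = poly (poly p [:z:]) x"

definition is_faulhaber :: "nat \<Rightarrow> real poly poly \<Rightarrow> bool" where
  "is_faulhaber r p \<longleftrightarrow>
     (\<forall>x. \<forall>n\<ge>1. eval2 p x (real n) = (\<Sum>k = 1..n. real k ^ r * (x - real k) ^ r))"

definition faulhaber :: "nat \<Rightarrow> real poly poly" where
  "faulhaber r = (THE p. is_faulhaber r p)"

definition f_fun :: "nat \<Rightarrow> real \<Rightarrow> real \<Rightarrow> real" where
  "f_fun y x z = (\<Sum>r = 0..y. A_coef y r * eval2 (faulhaber r) x z)"

definition g_fun :: "nat \<Rightarrow> real \<Rightarrow> real" where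
  "g_fun v x = x ^ (2 * v + 1)"

lemma eval2_simps:
  "eval2 0 x z = 0"
  "eval2 (p + q) x z = eval2 p x z + eval2 q x z"
  "eval2 (p - q) x z = eval2 p x z - eval2 q x z"
  "eval2 (p * q) x z = eval2 p x z * eval2 q x z"
  "eval2 (p ^ i) x z = eval2 p x z ^ i"
  "eval2 [:[:0, 1:]:] x z = x"
  "eval2 [:0, 1:] x z = z"
  "eval2 [:[:c:]:] x z = c"
  "eval2 1 x z = 1"
  "eval2 (smult a p) x z = poly a x * eval2 p x z"
  by (simp_all add: eval2_def poly_power)

lemma eval2_sum: "eval2 (sum p I) x z = (\<Sum>i\<in>I. eval2 (p i) x z)"
  by (simp add: eval2_def poly_sum)

lemma eval2_eqI:
  assumes "\<And>x n. n \<ge> 1 \<Longrightarrow> eval2 p x (real n) = eval2 q x (real n)"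
  shows "p = q"
proof -
  have "poly (p - q) [:real n:] = 0" if "n \<ge> 1" for n
  proof -
    have "poly (poly (p - q) [:real n:]) x = 0" for x
      using assms[OF that, of x] by (simp add: eval2_def)
    then show ?thesis using poly_all_0_iff_0 by blast
  qed
  then have "(\<lambda>n. [:real n:]) ` {1..} \<subseteq> {c. poly (p - q) c = 0}" by auto
  moreover have "infinite ((\<lambda>n. [:real n:]) ` {1..})"
    by (subst finite_image_iff) (auto simp: inj_on_def infinite_Ici)
  ultimately have "infinite {c. poly (p - q) c = 0}"
    using finite_subset by blast
  then have "p - q = 0" using poly_roots_finite by blast
  then show ?thesis by simp
qed

lemma power_sum_poly:
  "\<exists>p. \<forall>x n. eval2 p x (real n) = (\<Sum>k = 1..n. real k ^ j)"
proof (induction j rule: less_induct)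
  case (less j)
  then obtain P where P: "\<And>i x n. i < j \<Longrightarrow> eval2 (P i) x (real n) = (\<Sum>k = 1..n. real k ^ i)"
    by metis
  define p where "p = [:[:1 / real (Suc j):]:] *
    (([:0, 1:] + 1) ^ Suc j - 1 - (\<Sum>i<j. [:[:real (Suc j choose i):]:] * P i))"
  have "eval2 p x (real n) = (\<Sum>k = 1..n. real k ^ j)" for x n
  proof -
    have "(real n + 1) ^ Suc j - 1 = (\<Sum>k = 1..n. (real k + 1) ^ Suc j - real k ^ Suc j)"
      by (induction n) (auto simp: algebra_simps)
    also have "\<dots> = (\<Sum>k = 1..n. \<Sum>i\<le>j. real (Suc j choose i) * real k ^ i)"
      by (intro sum.cong refl) (subst binomial_ring, simp)
    also have "\<dots> = (\<Sum>i\<le>j. real (Suc j choose i) * (\<Sum>k = 1..n. real k ^ i))"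
      by (subst sum.swap) (simp add: sum_distrib_left)
    also have "\<dots> = (\<Sum>i<j. real (Suc j choose i) * (\<Sum>k = 1..n. real k ^ i))
        + real (Suc j) * (\<Sum>k = 1..n. real k ^ j)"
      by (simp add: lessThan_Suc_atMost[symmetric] del: of_nat_Suc)
    finally show ?thesis
      by (simp add: p_def eval2_simps eval2_sum P field_simps del: of_nat_Suc binomial_Suc_Suc power_Suc)
  qed
  then show ?case by blast
qed

text \<open>Existence and uniqueness, so that the definite description in \<open>faulhaber\<close> is meaningful.\<close>

lemma ex1_faulhaber: "\<exists>!p. is_faulhaber r p"
proof (rule ex_ex1I)
  obtain P where P: "\<And>j x n. eval2 (P j) x (real n) = (\<Sum>k = 1..n. real k ^ j)"
    using power_sum_poly by metis
  define p where "p = (\<Sum>i\<le>r. [:[:real (r choose i) * (-1) ^ i:]:] * [:[:0, 1:]:] ^ (r - i) * P (r + i))"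
  have "eval2 p x (real n) = (\<Sum>k = 1..n. real k ^ r * (x - real k) ^ r)" for x n
  proof -
    have "real k ^ r * (x - real k) ^ r
        = (\<Sum>i\<le>r. real (r choose i) * (-1) ^ i * x ^ (r - i) * real k ^ (r + i))" for k
    proof -
      have "(x - real k) ^ r = (- real k + x) ^ r" by simp
      also have "\<dots> = (\<Sum>i\<le>r. real (r choose i) * (- real k) ^ i * x ^ (r - i))"
        by (rule binomial_ring)
      finally show ?thesis
        by (simp add: sum_distrib_left power_add power_minus[of "real k"] mult_ac)
    qed
    then show ?thesis
      by (simp add: p_def eval2_simps eval2_sum P sum_distrib_left mult_ac) (rule sum.swap)
  qed
  then show "\<exists>p. is_faulhaber r p" by (auto simp: is_faulhaber_def)
next
  fix p q assume "is_faulhaber r p" "is_faulhaber r q"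
  then show "p = q" by (intro eval2_eqI) (auto simp: is_faulhaber_def)
qed

lemma eval2_faulhaber:
  "n \<ge> 1 \<Longrightarrow> eval2 (faulhaber r) x (real n) = (\<Sum>k = 1..n. real k ^ r * (x - real k) ^ r)"
  using theI'[OF ex1_faulhaber[of r]] by (simp add: faulhaber_def is_faulhaber_def)

lemma eval2_map_poly: "eval2 p x z = poly (map_poly (\<lambda>c. poly c x) p) z"
  unfolding eval2_def by (induction p) (auto simp: map_poly_pCons)

text \<open>Both partial derivatives of \<open>f_fun\<close> exist everywhere, so \<open>deriv\<close> is meaningful for them.\<close>

lemma f_fun_differentiable:
  "(\<lambda>x. f_fun y x z) field_differentiable at x"
  "(\<lambda>z. f_fun y x z) field_differentiable at z"
proof -
  have poly_fd: "poly q field_differentiable at a" for q :: "real poly" and a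
    using poly_DERIV field_differentiable_def by blast
  show "(\<lambda>x. f_fun y x z) field_differentiable at x"
    unfolding f_fun_def eval2_def by (intro derivative_intros field_differentiable_sum poly_fd)
  show "(\<lambda>z. f_fun y x z) field_differentiable at z"
    unfolding f_fun_def eval2_map_poly by (intro derivative_intros field_differentiable_sum poly_fd)
qed

end

theory Submission
  imports Defs
begin

text \<open>
  The whole content is the identity \<open>f_fun v u u = u ^ (2 * v + 1)\<close> on the diagonal: the chain rule
  for \<open>u \<mapsto> (u, u)\<close> (\<open>deriv_eval2_diagonal\<close>) then gives the claim. Both sides of the identity are
  polynomials in \<open>u\<close>, so it suffices to check it at positive integers, where \<open>f_fun\<close> is an honest
  finite sum and the identity reads
  \<open>n ^ (2m+1) = (\<Sum>r\<le>m. A_coef m r * T r n)\<close> with \<open>T r n = (\<Sum>k<n. k ^ r * (n - k) ^ r)\<close>.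

  To prove that, \<open>T r n\<close> is expanded in powers of \<open>n\<close> (\<open>symmetric_power_sum\<close>). The Euler--Maclaurin
  formula is exact for polynomials (\<open>euler_maclaurin_poly\<close>); applied to \<open>q x = x ^ r * (n - x) ^ r\<close> it
  yields the integral of \<open>q\<close> over \<open>[0, n]\<close>, a Beta integral, plus boundary terms
  \<open>B\<^sub>i / i!\<close> times the difference of the \<open>(i-1)\<close>-st derivatives of \<open>q\<close> at \<open>n\<close> and \<open>0\<close>.
  Because \<open>q\<close> is invariant under \<open>x \<mapsto> n - x\<close>, that difference vanishes for odd \<open>i\<close> and is twice
  the contribution of the endpoint \<open>0\<close>, up to sign, for even \<open>i\<close>. So \<open>T r n\<close> contains only the odd powers
  \<open>n ^ (2t+1)\<close> with \<open>t \<le> r\<close>, and \<open>n ^ (2r+1)\<close> has coefficient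
  \<open>1 / ((2r+1) * (2r choose r))\<close>. The recursion for \<open>A_coef\<close> is precisely the triangular system
  saying that in the combination above every power below \<open>n ^ (2m+1)\<close> cancels
  (\<open>odd_power_as_sum\<close>).
\<close>

section \<open>Bernoulli numbers and the Euler--Maclaurin formula for polynomials\<close>

text \<open>
  The recursion that defines the Bernoulli numbers, divided by \<open>n!\<close>. Equivalently, the generating
  series \<open>\<Sum> B\<^sub>k x^k / k!\<close> times \<open>exp x - 1\<close> is \<open>x\<close>; this is the form in which the convolution with
  Taylor coefficients below uses it.
\<close>

lemma sum_bernoulli_over_fact:
  "(\<Sum>k<n. bernoulli k / (fact k * fact (n - k))) = (if n = 1 then 1 else 0)"
proof (cases n)
  case 0
  then show ?thesis by simp
next
  case (Suc m)
  have "(\<Sum>k<Suc m. real (Suc m choose k) * bernoulli k) = (if m = 0 then 1 else 0)"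
    using bernoulli.simps[of m] by (auto simp: bernoulli.simps[of 0] field_simps simp del: of_nat_Suc binomial_Suc_Suc)
  moreover have "real (Suc m choose k) * bernoulli k
      = fact (Suc m) * (bernoulli k / (fact k * fact (Suc m - k)))" if "k < Suc m" for k
    using that by (subst binomial_fact) (auto simp del: fact_Suc)
  ultimately have "fact (Suc m) * (\<Sum>k<Suc m. bernoulli k / (fact k * fact (Suc m - k)))
      = (if m = 0 then 1 else 0)"
    unfolding sum_distrib_left by (simp del: fact_Suc sum.lessThan_Suc cong: sum.cong_simp)
  then show ?thesis unfolding Suc
    by (cases "m = 0") (simp_all del: fact_Suc sum.lessThan_Suc add: bernoulli.simps[of 0])
qed

lemma higher_pderiv_eq_0:
  fixes p :: "real poly"
  assumes "degree p < n"
  shows "(pderiv ^^ n) p = 0"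
  using assms by (intro poly_eqI) (simp add: coeff_higher_pderiv coeff_eq_0)

text \<open>
  Maclaurin's theorem for \<open>h \<mapsto> p (x + h)\<close>, whose remainder vanishes since it involves a derivative
  beyond the degree.
\<close>

lemma poly_taylor:
  fixes p :: "real poly"
  assumes "degree p \<le> N"
  shows "poly p (x + h) = (\<Sum>j\<le>N. poly ((pderiv ^^ j) p) x / fact j * h ^ j)"
proof -
  have "((\<lambda>h. poly ((pderiv ^^ m) p) (x + h)) has_real_derivative
          poly ((pderiv ^^ Suc m) p) (x + h)) (at h)" for m h
    by (auto intro!: derivative_eq_intros DERIV_chain2[OF poly_DERIV])
  then obtain t where "poly p (x + h) = (\<Sum>m<Suc N. poly ((pderiv ^^ m) p) (x + 0) / fact m * h ^ m)
      + poly ((pderiv ^^ Suc N) p) (x + t) / fact (Suc N) * h ^ Suc N"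
    using Maclaurin_all_le[of "\<lambda>m h. poly ((pderiv ^^ m) p) (x + h)" "\<lambda>h. poly p (x + h)" h "Suc N"]
    by auto
  moreover have "(pderiv ^^ Suc N) p = 0"
    using assms by (intro higher_pderiv_eq_0) simp
  ultimately show ?thesis by (simp only: lessThan_Suc_atMost) simp
qed

text \<open>
  In operator form: with \<open>D\<close> the derivative, the shift by \<open>1\<close> is \<open>exp D\<close>, and
  \<open>D / (exp D - 1)\<close>, applied to \<open>(exp D - 1) Q\<close>, returns \<open>D Q\<close>. Concretely, Taylor expansion of each
  term produces a double sum over \<open>i + j \<le> N\<close>; collecting it by \<open>s = i + j\<close> leaves the Bernoulli
  convolution as the coefficient of the \<open>s\<close>-th derivative.
\<close>

lemma bernoulli_higher_pderiv_difference:
  fixes Q :: "real poly"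
  assumes "degree Q \<le> N"
  shows "(\<Sum>i\<le>N. bernoulli i / fact i * (poly ((pderiv ^^ i) Q) (x + 1) - poly ((pderiv ^^ i) Q) x))
       = poly (pderiv Q) x"
proof -
  let ?D = "\<lambda>i. poly ((pderiv ^^ i) Q) x"
  have "poly ((pderiv ^^ i) Q) (x + 1) = (\<Sum>j\<le>N - i. ?D (i + j) / fact j)" for i
  proof -
    have "(pderiv ^^ j) ((pderiv ^^ i) Q) = (pderiv ^^ (i + j)) Q" for j
      by (metis add.commute comp_apply funpow_add)
    then show ?thesis
      using poly_taylor[of "(pderiv ^^ i) Q" "N - i" x 1] assms
      by (simp add: degree_higher_pderiv diff_le_mono)
  qed
  then have "(\<Sum>i\<le>N. bernoulli i / fact i * poly ((pderiv ^^ i) Q) (x + 1))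
      = (\<Sum>i\<le>N. \<Sum>j\<le>N - i. bernoulli i / fact i * (?D (i + j) / fact j))"
    by (simp add: sum_distrib_left)
  also have "\<dots> = (\<Sum>(i, j)\<in>{(i, j). i + j \<le> N}. bernoulli i / fact i * (?D (i + j) / fact j))"
    by (subst sum.Sigma) (auto intro!: sum.cong)
  also have "\<dots> = (\<Sum>s\<le>N. \<Sum>i\<le>s. bernoulli i / fact i * (?D s / fact (s - i)))"
    by (subst sum.triangle_reindex_eq) simp
  also have "\<dots> = (\<Sum>s\<le>N. bernoulli s / fact s * ?D s
      + ?D s * (\<Sum>i<s. bernoulli i / (fact i * fact (s - i))))"
    by (intro sum.cong refl) (simp add: lessThan_Suc_atMost[symmetric] sum_distrib_left field_simps)
  also have "\<dots> = (\<Sum>s\<le>N. bernoulli s / fact s * ?D s) + (\<Sum>s\<le>N. if s = 1 then ?D 1 else 0)"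
    unfolding sum.distrib sum_bernoulli_over_fact by (intro arg_cong2[of _ _ _ _ "(+)"] sum.cong) auto
  also have "(\<Sum>s\<le>N. if s = 1 then ?D 1 else 0) = ?D 1"
    using assms higher_pderiv_eq_0[of Q 1] by (cases "N = 0") auto
  finally show ?thesis by (simp add: right_diff_distrib sum_subtractf)
qed

text \<open>The previous lemma telescopes. The term \<open>i = 0\<close> is the integral of \<open>pderiv Q\<close>.\<close>

lemma euler_maclaurin_poly:
  fixes Q :: "real poly"
  assumes "degree Q \<le> N"
  shows "(\<Sum>k<n. poly (pderiv Q) (real k))
       = (\<Sum>i\<le>N. bernoulli i / fact i * (poly ((pderiv ^^ i) Q) (real n) - poly ((pderiv ^^ i) Q) 0))"
proof (induction n)
  case (Suc n)
  show ?case
    unfolding sum.lessThan_Suc Suc bernoulli_higher_pderiv_difference[OF assms, of "real n", symmetric]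
      sum.distrib[symmetric]
    by (intro sum.cong refl) (simp add: algebra_simps)
qed simp

section \<open>The symmetric power sum\<close>

text \<open>
  The Beta integral \<open>\<integral> x^a (c - x)^b dx\<close> over \<open>[0, c]\<close>, in terms of an explicit polynomial
  antiderivative because that is what the Euler--Maclaurin formula takes as input. The induction on
  \<open>b\<close> is integration by parts.
\<close>

lemma beta_antiderivative:
  fixes c :: real
  shows "\<exists>Q. pderiv Q = monom 1 a * [:c, -1:] ^ b \<and> poly Q 0 = 0 \<and>
    poly Q c = fact a * fact b / fact (a + b + 1) * c ^ (a + b + 1)"
proof (induction b arbitrary: a)
  case 0
  have "pderiv (monom (1 / real (Suc a)) (Suc a)) = monom 1 a"
    by (simp add: pderiv_monom del: of_nat_Suc)
  then show ?case
    by (intro exI[of _ "monom (1 / real (Suc a)) (Suc a)"]) (simp add: poly_monom)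
next
  case (Suc b)
  then obtain Q where Q: "pderiv Q = monom 1 (Suc a) * [:c, -1:] ^ b" "poly Q 0 = 0"
    "poly Q c = fact (Suc a) * fact b / fact (Suc a + b + 1) * c ^ (Suc a + b + 1)"
    by blast
  define R where "R = smult (1 / real (Suc a))
    (monom 1 (Suc a) * [:c, -1:] ^ Suc b + smult (real (Suc b)) Q)"
  have D: "pderiv ([:c, -1:] ^ Suc b) = smult (- real (Suc b)) ([:c, -1:] ^ b)"
    by (subst pderiv_power_Suc) (simp add: pderiv_pCons del: of_nat_Suc)
  have "poly (pderiv R) x = poly (monom 1 a * [:c, -1:] ^ Suc b) x" for x
    unfolding R_def pderiv_smult pderiv_add pderiv_mult D Q(1)
    by (simp add: pderiv_monom poly_monom poly_power field_simps del: of_nat_Suc)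
  then have "pderiv R = monom 1 a * [:c, -1:] ^ Suc b"
    by (intro poly_eq_poly_eq_iff[THEN iffD1] ext)
  moreover have "poly R 0 = 0"
    by (simp add: R_def Q poly_monom)
  moreover have "poly R c = fact a * fact (Suc b) / fact (a + Suc b + 1) * c ^ (a + Suc b + 1)"
  proof -
    have "poly R c = 1 / real (Suc a) * (real (Suc b) * poly Q c)"
      by (simp add: R_def poly_monom poly_power del: of_nat_Suc)
    also have "\<dots> = 1 / real (Suc a) * (real (Suc b) *
        (real (Suc a) * fact a * fact b / fact (a + Suc b + 1) * c ^ (a + Suc b + 1)))"
      by (simp only: Q(3) fact_Suc[of a] add_Suc add_Suc_right)
    also have "\<dots> = fact a * fact (Suc b) / fact (a + Suc b + 1) * c ^ (a + Suc b + 1)"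
      by (simp only: fact_Suc[of b]) (simp del: of_nat_Suc fact_Suc power_Suc)
    finally show ?thesis .
  qed
  ultimately show ?case by blast
qed

lemma higher_pderiv_reflect:
  fixes q :: "real poly"
  shows "(pderiv ^^ j) (pcompose q [:c, -1:]) = smult ((-1) ^ j) (pcompose ((pderiv ^^ j) q) [:c, -1:])"
proof (induction j)
  case (Suc j)
  have "pderiv [:c, -1:] = [:-1:]"
    by (simp add: pderiv_pCons)
  then have "(pderiv ^^ Suc j) (pcompose q [:c, -1:])
      = smult ((-1) ^ j) (pcompose (pderiv ((pderiv ^^ j) q)) [:c, -1:] * [:-1:])"
    by (simp only: funpow.simps comp_apply Suc pderiv_smult pderiv_pcompose)
  then show ?case by simp
qed simp

lemma poly_higher_pderiv_0:
  fixes q :: "real poly"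
  shows "poly ((pderiv ^^ j) q) 0 = fact j * coeff q j"
  by (simp only: poly_0_coeff_0 coeff_higher_pderiv pochhammer_fact of_nat_Suc of_nat_0 add_0 add_0_right)

text \<open>
  Euler--Maclaurin for \<open>x^r (n - x)^r\<close>. The reflection symmetry kills the terms with odd Bernoulli
  index, the one with \<open>B\<^sub>1\<close> included. Writing the surviving even index as \<open>2 (r - t)\<close> gives the sum over \<open>t\<close>.
\<close>

lemma symmetric_power_sum:
  "(\<Sum>k<n. real k ^ r * (real n - real k) ^ r) =
     real n ^ (2 * r + 1) / real ((2 * r + 1) * (2 * r choose r)) +
     (\<Sum>t<r. (-1) ^ r * bernoulli (2 * r - 2 * t) / (real r - real t) * real (r choose (2 * t + 1))
        * real n ^ (2 * t + 1))"
proof -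
  define c where "c = real n"
  define q where "q = monom 1 r * [:c, -1:] ^ r"
  obtain Q where Q: "pderiv Q = q" "poly Q 0 = 0"
    "poly Q c = fact r * fact r / fact (2 * r + 1) * c ^ (2 * r + 1)"
    using beta_antiderivative[of r c r] unfolding q_def mult_2 by blast
  have poly_q: "poly q x = x ^ r * (c - x) ^ r" for x
    by (simp add: q_def poly_monom poly_power)
  have q_sym: "pcompose q [:c, -1:] = q"
    by (intro poly_eq_poly_eq_iff[THEN iffD1] ext) (simp add: poly_pcompose poly_q mult.commute)
  have "degree q \<le> r + r"
    unfolding q_def
    by (intro degree_mult_le[THEN order_trans] add_mono degree_power_le[THEN order_trans])
       (auto simp: degree_monom_le)
  then have deg: "degree Q \<le> Suc (2 * r)"
    using degree_pderiv[of Q] Q(1) by simp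
  have coeff_q: "coeff q j = (if j < r then 0
      else real (r choose (j - r)) * (-1) ^ (j - r) * c ^ (r - (j - r)))" for j
  proof -
    have "coeff ([:c, -1:] ^ r) i = real (r choose i) * (-1) ^ i * c ^ (r - i)" for i
    proof (cases "i \<le> r")
      case True
      then show ?thesis by (simp add: coeff_linear_poly_power)
    next
      case False
      moreover have "degree ([:c, -1:] ^ r) \<le> r"
        using degree_power_le[of "[:c, -1:]" r] by simp
      ultimately show ?thesis by (simp add: coeff_eq_0 binomial_eq_0)
    qed
    then show ?thesis by (simp only: q_def coeff_monom_mult) simp
  qed
  have diff: "poly ((pderiv ^^ j) q) c - poly ((pderiv ^^ j) q) 0
      = ((-1) ^ j - 1) * fact j * coeff q j" for j
  proof -
    have "poly ((pderiv ^^ j) q) c = poly (smult ((-1) ^ j) (pcompose ((pderiv ^^ j) q) [:c, -1:])) c"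
      using higher_pderiv_reflect[of j q c] by (simp only: q_sym)
    also have "\<dots> = (-1) ^ j * poly ((pderiv ^^ j) q) 0"
      by (simp add: poly_pcompose)
    finally show ?thesis by (simp only: poly_higher_pderiv_0 left_diff_distrib mult_1 mult.assoc)
  qed
  \<comment> \<open>The boundary term with Bernoulli index \<open>j + 1\<close>, zero for even \<open>j\<close>.\<close>
  define h where "h j = bernoulli (Suc j) / real (Suc j) * ((-1) ^ j - 1) * coeff q j" for j
  have "(\<Sum>k<n. real k ^ r * (real n - real k) ^ r) = (\<Sum>k<n. poly (pderiv Q) (real k))"
    by (simp add: Q poly_q c_def)
  also have "\<dots> = (\<Sum>i\<le>Suc (2 * r). bernoulli i / fact i *
      (poly ((pderiv ^^ i) Q) c - poly ((pderiv ^^ i) Q) 0))"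
    unfolding c_def by (rule euler_maclaurin_poly[OF deg])
  also have "\<dots> = poly Q c + (\<Sum>j\<le>2 * r. bernoulli (Suc j) / fact (Suc j) *
      (poly ((pderiv ^^ j) q) c - poly ((pderiv ^^ j) q) 0))"
    by (subst sum.atMost_Suc_shift)
       (simp add: Q bernoulli.simps[of 0] funpow_swap1 del: fact_Suc)
  also have "(\<Sum>j\<le>2 * r. bernoulli (Suc j) / fact (Suc j) *
      (poly ((pderiv ^^ j) q) c - poly ((pderiv ^^ j) q) 0)) = (\<Sum>j\<le>2 * r. h j)"
    by (intro sum.cong refl) (simp add: diff h_def field_simps del: of_nat_Suc)
  also have "\<dots> = (\<Sum>j | j \<le> 2 * r \<and> odd j. h j)"
    by (intro sum.mono_neutral_right) (auto simp: h_def)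
  also have "\<dots> = (\<Sum>t<r. h (2 * (r - t) - 1))"
    by (rule sum.reindex_bij_witness[of _ "\<lambda>t. 2 * (r - t) - 1" "\<lambda>j. r - Suc j div 2"])
       (auto elim!: oddE)
  also have "\<dots> = (\<Sum>t<r. (-1) ^ r * bernoulli (2 * r - 2 * t) / (real r - real t)
      * real (r choose (2 * t + 1)) * c ^ (2 * t + 1))"
  proof (intro sum.cong refl)
    fix t assume "t \<in> {..<r}"
    then have t: "t < r" by simp
    \<comment> \<open>\<open>j\<close> counts derivatives of \<open>q\<close>, which itself is already a derivative of \<open>Q\<close>: hence the
      offset by one from the Bernoulli index.\<close>
    define j where "j = 2 * (r - t) - 1"
    have j: "odd j" "Suc j = 2 * r - 2 * t" using t by (auto simp: j_def)
    have Sj: "real (Suc j) = 2 * (real r - real t)" using t j(2) by (simp add: of_nat_diff)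
    have cq: "coeff q j = - ((-1) ^ r * real (r choose (2 * t + 1)) * c ^ (2 * t + 1))"
    proof (cases "2 * t + 1 \<le> r")
      case True
      then obtain s where s: "r = 2 * t + 1 + s" using le_Suc_ex by blast
      have "j - r = s" "\<not> j < r" "r - s = 2 * t + 1" using s by (auto simp: j_def)
      moreover have "r choose s = r choose (2 * t + 1)"
        using s binomial_symmetric[of s r] by simp
      moreover have "(-1::real) ^ r = - ((-1) ^ s)" unfolding s by (simp add: power_add power_mult)
      ultimately show ?thesis by (simp add: coeff_q)
    next
      case False
      then have "j < r" using t by (auto simp: j_def)
      then show ?thesis using False by (simp add: coeff_q binomial_eq_0)
    qed
    have "h j = bernoulli (2 * r - 2 * t) / (2 * (real r - real t)) * (-2) * coeff q j"
      unfolding h_def Sj using j by simp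
    also have "\<dots> = (-1) ^ r * bernoulli (2 * r - 2 * t) / (real r - real t)
      * real (r choose (2 * t + 1)) * c ^ (2 * t + 1)"
      using t by (simp add: cq field_simps)
    finally show "h (2 * (r - t) - 1) = (-1) ^ r * bernoulli (2 * r - 2 * t) / (real r - real t)
      * real (r choose (2 * t + 1)) * c ^ (2 * t + 1)"
      by (simp add: j_def)
  qed
  also have "poly Q c = c ^ (2 * r + 1) / real ((2 * r + 1) * (2 * r choose r))"
    by (simp add: Q(3) binomial_fact field_simps)
  finally show ?thesis by (simp add: c_def)
qed

section \<open>Odd powers as sums of symmetric power sums\<close>

text \<open>
  The defining recursion solved for the coefficient that \<open>A_coef m t\<close> contributes to \<open>n ^ (2t+1)\<close>:
  it is the negative of what all larger \<open>d\<close> contribute to the same power. Extending the range from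
  \<open>d \<ge> 2t+1\<close> to \<open>d > t\<close> only adds terms with a zero binomial coefficient, and matches the range of
  \<open>symmetric_power_sum\<close>.
\<close>

lemma A_coef_recursion:
  assumes "t < m"
  shows "A_coef m t / real ((2 * t + 1) * (2 * t choose t)) =
    - (\<Sum>d\<in>{t<..m}. A_coef m d *
        ((-1) ^ d * bernoulli (2 * d - 2 * t) / (real d - real t) * real (d choose (2 * t + 1))))"
proof -
  have "A_coef m t / real ((2 * t + 1) * (2 * t choose t)) =
    (\<Sum>d = 2 * t + 1..m. A_coef m d * real (d choose (2 * t + 1)) *
              ((-1) ^ (d - 1) / (real d - real t)) * bernoulli (2 * d - 2 * t))"
    using assms by (subst A_coef.simps) (simp del: of_nat_mult of_nat_add)
  also have "\<dots> = (\<Sum>d\<in>{t<..m}. A_coef m d * real (d choose (2 * t + 1)) *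
              ((-1) ^ (d - 1) / (real d - real t)) * bernoulli (2 * d - 2 * t))"
    by (intro sum.mono_neutral_left) (auto simp: binomial_eq_0)
  also have "\<dots> = (\<Sum>d\<in>{t<..m}. - (A_coef m d *
        ((-1) ^ d * bernoulli (2 * d - 2 * t) / (real d - real t) * real (d choose (2 * t + 1)))))"
  proof (intro sum.cong refl)
    fix d assume "d \<in> {t<..m}"
    then obtain e where "d = Suc e" by (cases d) auto
    then show "A_coef m d * real (d choose (2 * t + 1)) *
              ((-1) ^ (d - 1) / (real d - real t)) * bernoulli (2 * d - 2 * t) =
      - (A_coef m d * ((-1) ^ d * bernoulli (2 * d - 2 * t) / (real d - real t)
          * real (d choose (2 * t + 1))))"
      by simp
  qed
  finally show ?thesis by (simp add: sum_negf)
qed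

text \<open>
  Interchanging the sums collects the coefficient of each \<open>n ^ (2t+1)\<close>. It is zero for \<open>t < m\<close> by
  \<open>A_coef_recursion\<close>, and \<open>A_coef m m\<close> is normalised to give \<open>1\<close> for \<open>t = m\<close>.
\<close>

lemma odd_power_as_sum:
  "(\<Sum>r\<le>m. A_coef m r * (\<Sum>k<n. real k ^ r * (real n - real k) ^ r)) = real n ^ (2 * m + 1)"
proof -
  define w where "w d t = (-1) ^ d * bernoulli (2 * d - 2 * t) / (real d - real t)
    * real (d choose (2 * t + 1))" for d t
  define a where "a t = A_coef m t / real ((2 * t + 1) * (2 * t choose t))" for t
  have "(\<Sum>r\<le>m. A_coef m r * (\<Sum>k<n. real k ^ r * (real n - real k) ^ r)) =
    (\<Sum>r\<le>m. a r * real n ^ (2 * r + 1)) + (\<Sum>d\<le>m. \<Sum>t<d. A_coef m d * w d t * real n ^ (2 * t + 1))"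
    unfolding symmetric_power_sum sum.distrib[symmetric]
    by (intro sum.cong refl) (simp add: distrib_left sum_distrib_left a_def w_def mult.assoc)
  also have "(\<Sum>d\<le>m. \<Sum>t<d. A_coef m d * w d t * real n ^ (2 * t + 1)) =
    (\<Sum>t<m. \<Sum>d\<in>{t<..m}. A_coef m d * w d t * real n ^ (2 * t + 1))"
    unfolding sum.Sigma[OF finite_atMost ballI[OF finite_lessThan]]
      sum.Sigma[OF finite_lessThan ballI[OF finite_greaterThanAtMost]]
    by (rule sum.reindex_bij_witness[of _ "\<lambda>(t, d). (d, t)" "\<lambda>(d, t). (t, d)"]) auto
  also have "\<dots> = (\<Sum>t<m. - a t * real n ^ (2 * t + 1))"
  proof (intro sum.cong refl)
    fix t assume "t \<in> {..<m}"
    then have "- a t = (\<Sum>d\<in>{t<..m}. A_coef m d * w d t)"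
      using A_coef_recursion[of t m] by (simp only: a_def w_def lessThan_iff minus_minus)
    then show "(\<Sum>d\<in>{t<..m}. A_coef m d * w d t * real n ^ (2 * t + 1)) = - a t * real n ^ (2 * t + 1)"
      by (simp only: sum_distrib_right)
  qed
  also have "(\<Sum>r\<le>m. a r * real n ^ (2 * r + 1)) =
      (\<Sum>t<m. a t * real n ^ (2 * t + 1)) + a m * real n ^ (2 * m + 1)"
    by (simp add: lessThan_Suc_atMost[symmetric])
  also have "a m = 1"
    by (simp add: a_def A_coef.simps del: of_nat_mult of_nat_add)
  also have "(\<Sum>t<m. a t * real n ^ (2 * t + 1)) + 1 * real n ^ (2 * m + 1)
      + (\<Sum>t<m. - a t * real n ^ (2 * t + 1)) = real n ^ (2 * m + 1)"
    by (simp only: mult_minus_left sum_negf mult_1)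
  finally show ?thesis .
qed

section \<open>The diagonal of a polynomial in two variables\<close>

text \<open>
  The chain rule along the diagonal. Induction on the polynomial replaces total differentiability: the
  step is the product rule for \<open>a(x) + z * p(x, z)\<close>.
\<close>

lemma deriv_eval2_diagonal:
  "deriv (\<lambda>t. eval2 p t t) u = deriv (\<lambda>x. eval2 p x u) u + deriv (\<lambda>z. eval2 p u z) u"
proof -
  have "\<exists>Px Pz. ((\<lambda>x. eval2 p x u) has_field_derivative Px) (at u) \<and>
      ((\<lambda>z. eval2 p u z) has_field_derivative Pz) (at u) \<and>
      ((\<lambda>t. eval2 p t t) has_field_derivative Px + Pz) (at u)"
  proof (induction p)
    case 0
    show ?case by (rule exI[of _ 0], rule exI[of _ 0]) (simp add: eval2_simps)
  next
    case (pCons a p)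
    then obtain Px Pz where P: "((\<lambda>x. eval2 p x u) has_field_derivative Px) (at u)"
      "((\<lambda>z. eval2 p u z) has_field_derivative Pz) (at u)"
      "((\<lambda>t. eval2 p t t) has_field_derivative Px + Pz) (at u)" by blast
    have e: "eval2 (pCons a p) x z = poly a x + z * eval2 p x z" for x z
      by (simp add: eval2_def)
    show ?case unfolding e
      by (rule exI[of _ "poly (pderiv a) u + u * Px"], rule exI[of _ "eval2 p u u + u * Pz"])
         (auto intro!: derivative_eq_intros P simp: algebra_simps)
  qed
  then show ?thesis by (metis DERIV_imp_deriv)
qed

lemma f_fun_as_eval2: "\<exists>F. \<forall>x z. f_fun v x z = eval2 F x z"
  by (rule exI[of _ "\<Sum>r = 0..v. [:[:A_coef v r:]:] * faulhaber r"])
     (simp add: f_fun_def eval2_sum eval2_simps del: mult_pCons_left)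

text \<open>
  The bracket in \<open>f_fun\<close> sums over \<open>1 \<le> k \<le> n\<close>, whereas Euler--Maclaurin sums over \<open>0 \<le> k < n\<close>; the
  reflection \<open>k \<mapsto> n - k\<close> exchanges the two ranges and fixes the summand, also when \<open>r = 0\<close>.
\<close>

lemma f_fun_diagonal_nat:
  assumes "n \<ge> 1"
  shows "f_fun v (real n) (real n) = real n ^ (2 * v + 1)"
proof -
  have "(\<Sum>k = 1..n. real k ^ r * (real n - real k) ^ r) = (\<Sum>k<n. real k ^ r * (real n - real k) ^ r)"
    for r
    by (rule sum.reindex_bij_witness[of _ "\<lambda>k. n - k" "\<lambda>k. n - k"])
       (auto simp: of_nat_diff)
  then show ?thesis
    using assms
    by (simp add: f_fun_def eval2_faulhaber atLeast0AtMost odd_power_as_sum del: power_Suc)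
qed

lemma f_fun_diagonal: "f_fun v u u = g_fun v u"
proof -
  obtain F where F: "\<And>x z. f_fun v x z = eval2 F x z"
    using f_fun_as_eval2 by blast
  define G where "G = poly F [:0, 1:]"
  have G: "poly G t = eval2 F t t" for t
    unfolding G_def by (induction F) (simp_all add: eval2_def)
  have "real ` {1..} \<subseteq> {t. poly (G - monom 1 (2 * v + 1)) t = 0}"
    by (auto simp: G poly_monom F[symmetric] f_fun_diagonal_nat simp del: power_Suc)
  moreover have "infinite (real ` {1..})"
    by (subst finite_image_iff) (auto simp: inj_on_def infinite_Ici)
  ultimately have "G - monom 1 (2 * v + 1) = 0"
    using poly_roots_finite finite_subset by blast
  then have "G = monom 1 (2 * v + 1)" by simp
  then show ?thesis using G[of u] by (simp add: F g_fun_def poly_monom)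
qed

theorem theorem1p1:
  fixes v :: nat and u :: real
  shows "deriv (g_fun v) u = deriv (\<lambda>x. f_fun v x u) u + deriv (\<lambda>z. f_fun v u z) u"
proof -
  obtain F where F: "\<And>x z. f_fun v x z = eval2 F x z"
    using f_fun_as_eval2 by blast
  have "g_fun v = (\<lambda>t. eval2 F t t)"
    by (rule ext) (metis f_fun_diagonal F)
  then show ?thesis by (simp add: F deriv_eval2_diagonal)
qed

end
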